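(* Let $n$ be a positive integer, let $(X,\|\cdot,\dots,\cdot\|)$ be a real $n$-normed space, and let $Y=\{y_1,\dots,y_n\}$ be a linearly independent set of $n$ vectors in $X$, used to form the class-$m$ collections of $X$ for all $m\in\mathbb{N}$ with $1\le m\le n$. Then for every $m\in\mathbb{N}$ with $1\le m\le n$, a sequence $\{x_k\}\subset X$ is convergent with respect to the norms of the class-$1$ collection if and only if it is convergent with respect to the norms of the class-$m$ collection.
   Context: **$n$-norm.** Let $X$ be a real vector space with $\dim X\ge n$. An $n$-norm on $X$ is a function $\|\cdot,\dots,\cdot\|:X^n\to\mathbb{R}$ such that: (i) $\|x_1,\dots,x_n\|\ge 0$, with $\|x_1,\dots,x_n\|=0$ if and only if $x_1,\dots,x_n$ are linearly dependent; (ii) $\|x_1,\dots,x_n\|$ is invariant under permutation of its arguments; (iii) $\|\alpha x_1,x_2,\dots,x_n\|=|\alpha|\,\|x_1,x_2,\dots,x_n\|$ for all $\alpha\in\mathbb{R}$; (iv) $\|x_1+x_1',x_2,\dots,x_n\|\le\|x_1,x_2,\dots,x_n\|+\|x_1',x_2,\dots,x_n\|$. The pair $(X,\|\cdot,\dots,\cdot\|)$ is called an $n$-normed space. **Class-$m$ collection.** Fix a linearly independent set $Y=\{y_1,\dots,y_n\}\subset X$. For $1\le m\le n$ and indices $i_1<\dots<i_m$ in $\{1,\dots,n\}$, let $Y^0_{i_1,\dots,i_m}:=\mathrm{span}\,(Y\setminus\{y_{i_1},\dots,y_{i_m}\})$ and $X^*_{i_1,\dots,i_m}:=X/Y^0_{i_1,\dots,i_m}$,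 and write $\overline{u}$ for the coset of $u\in X$ in this quotient. The norm on $X^*_{i_1,\dots,i_m}$ is $$\|\overline{u}\|^*_{i_1,\dots,i_m}:=\sum_{s=1}^m \|u,y_1,\dots,y_{i_s-1},y_{i_s+1},\dots,y_n\|.$$ In particular, for $m=1$, $\|\overline{u}\|^*_j=\|u,y_1,\dots,y_{j-1},y_{j+1},\dots,y_n\|$. The class-$m$ collection is the set of all $\binom{n}{m}$ such quotient spaces, and "the norms of the class-$m$ collection" means all the norms $\|\cdot\|^*_{i_1,\dots,i_m}$ with $i_1<\dots<i_m$. **Convergence.** A sequence $\{x_k\}\subset X$ converges with respect to the norms of the class-$m$ collection to $x\in X$ if for every $\epsilon>0$ there exists $N\in\mathbb{N}$ such that for all $k\ge N$, $\|\overline{x_k-x}\|^*_{i_1,\dots,i_m}<\epsilon$ for every $i_1<\dots<i_m$ in $\{1,\dots,n\}$. It is convergent with respect to these norms if it converges to some $x\in X$. *)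

theory Defs
  imports "HOL-Library.Multiset" Complex_Main
begin

text \<open>The space \<open>X\<close> is a type of class \<^class>\<open>real_vector\<close>, and an \<open>n\<close>-tuple of vectors is a list of
  length \<open>n\<close>; the values of an \<open>n\<close>-norm on lists of any other length are irrelevant.\<close>

text \<open>Linear independence of a tuple, so that a tuple with a repeated entry is dependent.\<close>

definition lin_indep :: "'a::real_vector list \<Rightarrow> bool" where
  "lin_indep xs \<longleftrightarrow> distinct xs \<and> independent (set xs)"

text \<open>The first conjunct says \<open>dim X \<ge> n\<close>; it is not phrased with \<^const>\<open>dim\<close>, which is
  \<open>0\<close> on infinite-dimensional spaces.\<close>

definition n_norm :: "nat \<Rightarrow> ('a::real_vector list \<Rightarrow> real) \<Rightarrow> bool" where
  "n_norm n N \<longleftrightarrow>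
     (\<exists>B::'a set. finite B \<and> independent B \<and> card B = n) \<and>
     (\<forall>xs. length xs = n \<longrightarrow> 0 \<le> N xs) \<and>
     (\<forall>xs. length xs = n \<longrightarrow> (N xs = 0 \<longleftrightarrow> \<not> lin_indep xs)) \<and>
     (\<forall>xs xs'. length xs = n \<and> mset xs' = mset xs \<longrightarrow> N xs' = N xs) \<and>
     (\<forall>\<alpha> x xs. Suc (length xs) = n \<longrightarrow> N (\<alpha> *\<^sub>R x # xs) = \<bar>\<alpha>\<bar> * N (x # xs)) \<and>
     (\<forall>x x' xs. Suc (length xs) = n \<longrightarrow> N ((x + x') # xs) \<le> N (x # xs) + N (x' # xs))"

text \<open>Positions in \<open>y\<close> are counted from \<open>0\<close>, and \<open>i\<^sub>1 < \<dots> < i\<^sub>m\<close> is encoded as the set of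
  these indices.\<close>

definition class_indices :: "nat \<Rightarrow> nat \<Rightarrow> nat set set" where
  "class_indices n m = {I. I \<subseteq> {..<n} \<and> card I = m}"

definition omit :: "nat \<Rightarrow> 'a list \<Rightarrow> 'a list" where
  "omit i y = take i y @ drop (Suc i) y"

definition Y0 :: "'a::real_vector list \<Rightarrow> nat set \<Rightarrow> 'a set" where
  "Y0 y I = span (set y - (\<lambda>i. y ! i) ` I)"

text \<open>The element of \<open>X / Y0 y I\<close> represented by \<open>u\<close>.\<close>

definition coset :: "'a::real_vector list \<Rightarrow> nat set \<Rightarrow> 'a \<Rightarrow> 'a set" where
  "coset y I u = {u + w | w. w \<in> Y0 y I}"

text \<open>The norm of a coset is the common value of the sum at all its representatives \<open>u\<close>;
  \<open>quot_norm_coset\<close> below shows that it exists.\<close>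

definition quot_norm :: "('a::real_vector list \<Rightarrow> real) \<Rightarrow> 'a list \<Rightarrow> nat set \<Rightarrow> 'a set \<Rightarrow> real" where
  "quot_norm N y I U = (THE r. \<forall>u\<in>U. r = (\<Sum>i\<in>I. N (u # omit i y)))"

definition class_converges_to ::
  "('a::real_vector list \<Rightarrow> real) \<Rightarrow> 'a list \<Rightarrow> nat \<Rightarrow> (nat \<Rightarrow> 'a) \<Rightarrow> 'a \<Rightarrow> bool" where
  "class_converges_to N y m x l \<longleftrightarrow>
     (\<forall>\<epsilon>>0. \<exists>K. \<forall>k\<ge>K. \<forall>I\<in>class_indices (length y) m.
        quot_norm N y I (coset y I (x k - l)) < \<epsilon>)"

definition class_convergent ::
  "('a::real_vector list \<Rightarrow> real) \<Rightarrow> 'a list \<Rightarrow> nat \<Rightarrow> (nat \<Rightarrow> 'a) \<Rightarrow> bool" where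
  "class_convergent N y m x \<longleftrightarrow> (\<exists>l. class_converges_to N y m x l)"

lemma n_norm_add_span:
  assumes N: "n_norm n N" and len: "Suc (length xs) = n" and w: "w \<in> span (set xs)"
  shows "N ((u + w) # xs) = N (u # xs)"
proof -
  have zero: "N (v # xs) = 0" if "v \<in> span (set xs)" for v
  proof -
    have "\<not> lin_indep (v # xs)"
      using that by (auto simp: lin_indep_def independent_insert)
    then show ?thesis
      using N len by (simp add: n_norm_def)
  qed
  have tri: "N ((a + b) # xs) \<le> N (a # xs) + N (b # xs)" for a b
    using N len by (simp add: n_norm_def)
  have "N (u # xs) \<le> N ((u + w) # xs)"
    using tri[of "u + w" "- w"] zero[of "- w"] w by (simp add: span_neg)
  moreover have "N ((u + w) # xs) \<le> N (u # xs)"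
    using tri[of u w] zero[OF w] by simp
  ultimately show ?thesis by simp
qed

lemma quot_norm_coset:
  assumes N: "n_norm (length y) N" and I: "I \<subseteq> {..<length y}"
  shows "quot_norm N y I (coset y I u) = (\<Sum>i\<in>I. N (u # omit i y))"
proof -
  have rep: "(\<Sum>i\<in>I. N ((u + w) # omit i y)) = (\<Sum>i\<in>I. N (u # omit i y))"
    if w: "w \<in> Y0 y I" for w
  proof (rule sum.cong)
    fix i assume i: "i \<in> I"
    then have lt: "i < length y" using I by auto
    have "set y = insert (y ! i) (set (omit i y))"
      by (subst id_take_nth_drop[OF lt]) (auto simp: omit_def)
    then have "set y - (\<lambda>i. y ! i) ` I \<subseteq> set (omit i y)"
      using i by auto
    then have "w \<in> span (set (omit i y))"
      using w span_mono unfolding Y0_def by blast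
    then show "N ((u + w) # omit i y) = N (u # omit i y)"
      using N lt by (intro n_norm_add_span[OF N]) (auto simp: omit_def)
  qed simp
  have mem: "u \<in> coset y I u"
    unfolding coset_def Y0_def using span_zero by force
  show ?thesis
    unfolding quot_norm_def
  proof (rule the_equality)
    show "\<forall>v\<in>coset y I u. (\<Sum>i\<in>I. N (u # omit i y)) = (\<Sum>i\<in>I. N (v # omit i y))"
      using rep by (auto simp: coset_def)
  qed (use mem in auto)
qed

end

theory Submission
  imports Defs
begin

text \<open>Write \<open>a\<^sub>i(u)\<close> for the \<open>n\<close>-norm of \<open>u\<close> together with all \<open>y\<^sub>j\<close>, \<open>j \<noteq> i\<close>. Every norm
  of the class-\<open>m\<close> collection is a sum of \<open>m\<close> of the nonnegative numbers \<open>a\<^sub>1(u), \<dots>, a\<^sub>n(u)\<close>,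
  and each \<open>a\<^sub>i(u)\<close> is a summand of at least one of these norms because \<open>1 \<le> m \<le> n\<close>. Hence each
  \<open>a\<^sub>i(u)\<close> is bounded by some norm of the collection, while all norms of the collection are bounded
  by \<open>a\<^sub>1(u) + \<dots> + a\<^sub>n(u)\<close>. So convergence to \<open>l\<close> with respect to the class-\<open>m\<close> collection means
  that \<open>a\<^sub>i(x\<^sub>k - l)\<close> tends to \<open>0\<close> for every \<open>i\<close> (\<open>class_converges_to_iff_tendsto\<close>), and \<open>m\<close> does
  not occur in this condition. In particular both collections give the same limits.\<close>

lemma class_indices_containing:
  assumes "i < n" "1 \<le> m" "m \<le> n"
  obtains I where "I \<in> class_indices n m" "i \<in> I"
proof -
  have "m - 1 \<le> card ({..<n} - {i})"
    using assms by simp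
  then obtain J where J: "J \<subseteq> {..<n} - {i}" "card J = m - 1" "finite J"
    by (rule obtain_subset_with_card_n)
  then have "i \<notin> J"
    by auto
  then have "card (insert i J) = m"
    using J assms by simp
  then have "insert i J \<in> class_indices n m"
    using J assms by (auto simp: class_indices_def)
  then show ?thesis
    using that by blast
qed

lemma n_norm_omit_nonneg:
  assumes "n_norm (length y) N" "i < length y"
  shows "0 \<le> N (u # omit i y)"
  using assms by (simp add: n_norm_def omit_def)

text \<open>The choice of index set affects the norms only up to the two bounds that compare a sum of
  nonnegative terms with one of its terms and with the sum over all indices; neither bound
  affects which sequences tend to \<open>0\<close>.\<close>

lemma class_converges_to_iff_tendsto:
  assumes N: "n_norm (length y) N" and m: "1 \<le> m" "m \<le> length y"
  shows "class_converges_to N y m x l \<longleftrightarrow>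
           (\<forall>i<length y. (\<lambda>k. N ((x k - l) # omit i y)) \<longlonglongrightarrow> 0)"
proof
  assume conv: "class_converges_to N y m x l"
  show "\<forall>i<length y. (\<lambda>k. N ((x k - l) # omit i y)) \<longlonglongrightarrow> 0"
  proof (intro allI impI LIMSEQ_I)
    fix i and e :: real
    assume i: "i < length y" and e: "e > 0"
    obtain I where I: "I \<in> class_indices (length y) m" "i \<in> I"
      using class_indices_containing[OF i m] .
    then have I': "I \<subseteq> {..<length y}"
      by (simp add: class_indices_def)
    obtain K where K: "quot_norm N y I (coset y I (x k - l)) < e" if "k \<ge> K" for k
      using conv e I(1) unfolding class_converges_to_def by meson
    have "norm (N ((x k - l) # omit i y) - 0) < e" if "k \<ge> K" for k
    proof -
      have "N ((x k - l) # omit i y) \<le> (\<Sum>j\<in>I. N ((x k - l) # omit j y))"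
        using I(2) I' finite_subset[OF I'] n_norm_omit_nonneg[OF N]
        by (intro member_le_sum) auto
      also have "\<dots> < e"
        using K[OF that] quot_norm_coset[OF N I'] by simp
      finally show ?thesis
        using n_norm_omit_nonneg[OF N i] by simp
    qed
    then show "\<exists>K. \<forall>k\<ge>K. norm (N ((x k - l) # omit i y) - 0) < e"
      by blast
  qed
next
  assume lim: "\<forall>i<length y. (\<lambda>k. N ((x k - l) # omit i y)) \<longlonglongrightarrow> 0"
  then have total: "(\<lambda>k. \<Sum>i<length y. N ((x k - l) # omit i y)) \<longlonglongrightarrow> 0"
    by (intro tendsto_null_sum) auto
  show "class_converges_to N y m x l"
    unfolding class_converges_to_def
  proof (intro allI impI)
    fix e :: real
    assume "e > 0"
    \<comment> \<open>The sum over all indices bounds every norm of the collection, so one \<open>K\<close> serves them all.\<close>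
    then obtain K where K: "(\<Sum>i<length y. N ((x k - l) # omit i y)) < e" if "k \<ge> K" for k
      using order_tendstoD(2)[OF total] unfolding eventually_sequentially by blast
    have "quot_norm N y I (coset y I (x k - l)) < e"
      if "k \<ge> K" and "I \<in> class_indices (length y) m" for k I
    proof -
      have I': "I \<subseteq> {..<length y}"
        using that(2) by (simp add: class_indices_def)
      have "quot_norm N y I (coset y I (x k - l)) = (\<Sum>i\<in>I. N ((x k - l) # omit i y))"
        by (rule quot_norm_coset[OF N I'])
      also have "\<dots> \<le> (\<Sum>i<length y. N ((x k - l) # omit i y))"
        using I' n_norm_omit_nonneg[OF N] by (intro sum_mono2) auto
      also have "\<dots> < e"
        by (rule K[OF that(1)])
      finally show ?thesis .
    qed
    then show "\<exists>K. \<forall>k\<ge>K. \<forall>I\<in>class_indices (length y) m.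
                 quot_norm N y I (coset y I (x k - l)) < e"
      by blast
  qed
qed

theorem theorem2p3:
  fixes n m :: nat
    and N :: "'a::real_vector list \<Rightarrow> real"
    and y :: "'a list"
    and x :: "nat \<Rightarrow> 'a"
  assumes "n \<ge> 1"
    and "n_norm n N"
    and "length y = n" and "lin_indep y"
    and "1 \<le> m" and "m \<le> n"
  shows "class_convergent N y 1 x \<longleftrightarrow> class_convergent N y m x"
  using assms by (simp add: class_convergent_def class_converges_to_iff_tendsto)

end
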